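(* Let $G$ and $H$ be two connected graphs of orders $n, m \geq 2$, respectively, with $D(G) = k$ and $D(H) = k'$. If $k'' = \max\{k, k'\}$ and $D(G \circ H) = k''$, then $$\rho_{k''}(G \circ H) \leq \rho_k(G) + n\,\rho_{k'}(H).$$
   Context: Graphs are finite and simple; the order of a graph is its number of vertices. The corona product $G \circ H$ of two graphs $G$ and $H$ is the graph obtained by taking one copy of $G$ and $|V(G)|$ copies of $H$ and joining the $i$-th vertex of $G$ to every vertex in the $i$-th copy of $H$. For a graph $G$ with vertex set $V(G)$, a labeling $\phi : V(G) \to \{1,\ldots,r\}$ is $r$-distinguishing if for every non-trivial automorphism $\sigma \in \mathrm{Aut}(G)$ there is a vertex $x$ with $\phi(x) \neq \phi(\sigma x)$. The distinguishing number $D(G)$ is the least positive integer $r$ such that $G$ has an $r$-distinguishing labeling. If $D(G) = d$, the cost of $d$-distinguishing $G$, denoted $\rho_d(G)$, is the minimum size of a label class in any $d$-distinguishing labeling of $G$ (minimum over all such labelings and all $d$ label classes). *)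

theory Defs
  imports "Graph_Theory.Digraph_Isomorphism" "HOL-Combinatorics.Permutations"
    "HOL-Library.FuncSet"
begin

text \<open>A finite simple graph is a \<open>pair_graph\<close>: finite, symmetric and loopfree, so that an edge
  \<open>uv\<close> is represented by the two arcs \<open>(u,v)\<close> and \<open>(v,u)\<close>.\<close>

abbreviation graph_order :: "'a pair_pre_digraph \<Rightarrow> nat" where
  "graph_order G \<equiv> card (pverts G)"

text \<open>Vertex \<open>Inl u\<close> is the vertex \<open>u\<close> of \<open>G\<close>, and \<open>Inr (u, x)\<close> is the vertex \<open>x\<close> of the copy of
  \<open>H\<close> attached to \<open>u\<close>.\<close>

definition corona :: "'a pair_pre_digraph \<Rightarrow> 'b pair_pre_digraph \<Rightarrow> ('a + 'a \<times> 'b) pair_pre_digraph"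
  where
  "corona G H = \<lparr>
     pverts = Inl ` pverts G \<union> Inr ` (pverts G \<times> pverts H),
     parcs = {(Inl u, Inl v) | u v. (u, v) \<in> parcs G}
       \<union> {(Inr (u, x), Inr (u, y)) | u x y. u \<in> pverts G \<and> (x, y) \<in> parcs H}
       \<union> {(Inl u, Inr (u, x)) | u x. u \<in> pverts G \<and> x \<in> pverts H}
       \<union> {(Inr (u, x), Inl u) | u x. u \<in> pverts G \<and> x \<in> pverts H} \<rparr>"

text \<open>Automorphisms are extended by the identity outside the vertex set (this is part of
  \<open>permutes\<close>), so that \<open>id\<close> represents exactly the trivial automorphism.\<close>

definition automorphisms :: "'a pair_pre_digraph \<Rightarrow> ('a \<Rightarrow> 'a) set" where
  "automorphisms G = {\<sigma>. \<sigma> permutes pverts G \<and>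
     (\<forall>u\<in>pverts G. \<forall>v\<in>pverts G. (u, v) \<in> parcs G \<longleftrightarrow> (\<sigma> u, \<sigma> v) \<in> parcs G)}"

definition distinguishing_labeling :: "'a pair_pre_digraph \<Rightarrow> nat \<Rightarrow> ('a \<Rightarrow> nat) \<Rightarrow> bool" where
  "distinguishing_labeling G r \<phi> \<longleftrightarrow> \<phi> \<in> pverts G \<rightarrow> {1..r} \<and>
     (\<forall>\<sigma>\<in>automorphisms G. \<sigma> \<noteq> id \<longrightarrow> (\<exists>x\<in>pverts G. \<phi> x \<noteq> \<phi> (\<sigma> x)))"

definition distinguishing_number :: "'a pair_pre_digraph \<Rightarrow> nat" where
  "distinguishing_number G = (LEAST r. 1 \<le> r \<and> (\<exists>\<phi>. distinguishing_labeling G r \<phi>))"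

text \<open>The cost of \<open>d\<close>-distinguishing \<open>G\<close>, used only for \<open>d = distinguishing_number G\<close>. For such
  \<open>d\<close> and nonempty \<open>G\<close>, no label class is empty (lemma \<open>label_class_nonempty\<close> below), so it
  does not matter that the classes of all \<open>d\<close> labels are considered.\<close>

definition label_class :: "'a pair_pre_digraph \<Rightarrow> ('a \<Rightarrow> nat) \<Rightarrow> nat \<Rightarrow> 'a set" where
  "label_class G \<phi> i = {x \<in> pverts G. \<phi> x = i}"

definition distinguishing_cost :: "nat \<Rightarrow> 'a pair_pre_digraph \<Rightarrow> nat" where
  "distinguishing_cost d G = (LEAST s. \<exists>\<phi> i. distinguishing_labeling G d \<phi> \<and> i \<in> {1..d} \<and>
     s = card (label_class G \<phi> i))"

lemma pair_graph_corona:
  assumes "pair_graph G" "pair_graph H"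
  shows "pair_graph (corona G H)"
proof -
  interpret G: pair_graph G by fact
  interpret H: pair_graph H by fact
  have fin: "finite (pverts (corona G H))"
    by (simp add: corona_def)
  have sub: "parcs (corona G H) \<subseteq> pverts (corona G H) \<times> pverts (corona G H)"
    by (auto simp: corona_def dest: G.wellformed' H.wellformed')
  show ?thesis
  proof
    show "finite (parcs (corona G H))"
      using fin sub by (meson finite_SigmaI finite_subset)
    show "symmetric (with_proj (corona G H))"
      by (auto simp: symmetric_def corona_def sym_def
          intro: G.arcs_symmetric H.arcs_symmetric)
    show "fst e \<noteq> snd e" if "e \<in> parcs (corona G H)" for e
      using that by (auto simp: corona_def dest: G.no_loops' H.no_loops')
  qed (use fin sub in auto)
qed

lemma automorphisms_iff_digraph_isomorphism:
  assumes "pair_graph G"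
  shows "\<sigma> \<in> automorphisms G \<longleftrightarrow> \<sigma> permutes pverts G \<and>
    (\<exists>hom. pre_digraph.digraph_isomorphism (with_proj G) hom \<and> iso_verts hom = \<sigma> \<and>
       app_iso hom (with_proj G) = with_proj G)"
proof -
  interpret G: pair_graph G by fact
  show ?thesis
  proof (intro iffI conjI)
    assume a: "\<sigma> \<in> automorphisms G"
    then show p: "\<sigma> permutes pverts G" by (simp add: automorphisms_def)
    have arcs: "(u, v) \<in> parcs G \<longleftrightarrow> (\<sigma> u, \<sigma> v) \<in> parcs G"
      if "u \<in> pverts G" "v \<in> pverts G" for u v
      using a that by (simp add: automorphisms_def)
    let ?h = "\<lparr>iso_verts = \<sigma>, iso_arcs = map_prod \<sigma> \<sigma>, iso_head = snd, iso_tail = fst\<rparr>"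
    have inj: "inj \<sigma>" using p by (rule permutes_inj)
    have im: "map_prod \<sigma> \<sigma> ` parcs G = parcs G"
    proof
      show "map_prod \<sigma> \<sigma> ` parcs G \<subseteq> parcs G"
      proof
        fix e assume "e \<in> map_prod \<sigma> \<sigma> ` parcs G"
        then obtain u v where "(u, v) \<in> parcs G" "e = (\<sigma> u, \<sigma> v)" by auto
        then show "e \<in> parcs G" using arcs[of u v] G.wellformed'[of u v] by blast
      qed
      show "parcs G \<subseteq> map_prod \<sigma> \<sigma> ` parcs G"
      proof
        fix e assume e: "e \<in> parcs G"
        obtain x y where xy: "e = (x, y)" by fastforce
        obtain u v where uv: "x = \<sigma> u" "y = \<sigma> v" "u \<in> pverts G" "v \<in> pverts G"
          using e xy G.wellformed' permutes_image[OF p] by blast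
        then have "(u, v) \<in> parcs G" using e xy arcs[of u v] by blast
        then show "e \<in> map_prod \<sigma> \<sigma> ` parcs G" using uv xy by force
      qed
    qed
    have "inj_on (map_prod \<sigma> \<sigma>) (parcs G)"
      using inj by (metis prod.inj_map inj_on_subset subset_UNIV)
    then have "pre_digraph.digraph_isomorphism (with_proj G) ?h"
      using inj G.wf_digraph_axioms
      by (auto simp: pre_digraph.digraph_isomorphism_def intro: inj_on_subset)
    moreover have "app_iso ?h (with_proj G) = with_proj G"
      using im permutes_image[OF p] by (simp add: app_iso_def with_proj_def)
    ultimately show "\<exists>hom. pre_digraph.digraph_isomorphism (with_proj G) hom \<and>
        iso_verts hom = \<sigma> \<and> app_iso hom (with_proj G) = with_proj G"
      by (intro exI[of _ ?h]) simp
  next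
    assume "\<sigma> permutes pverts G \<and>
      (\<exists>hom. pre_digraph.digraph_isomorphism (with_proj G) hom \<and> iso_verts hom = \<sigma> \<and>
         app_iso hom (with_proj G) = with_proj G)"
    then obtain hom where p: "\<sigma> permutes pverts G"
      and iso: "pre_digraph.digraph_isomorphism (with_proj G) hom"
      and v: "iso_verts hom = \<sigma>" and eq: "app_iso hom (with_proj G) = with_proj G"
      by blast
    have "iso_arcs hom ` parcs G = parcs G" "iso_tail hom = fst" "iso_head hom = snd"
      using eq by (simp_all add: app_iso_def with_proj_def)
    moreover have "iso_arcs hom e = map_prod \<sigma> \<sigma> e" if "e \<in> parcs G" for e
      using iso that v calculation
      by (auto simp: pre_digraph.digraph_isomorphism_def prod_eq_iff)
    ultimately have im: "map_prod \<sigma> \<sigma> ` parcs G = parcs G"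
      using image_cong[of "parcs G" "parcs G" "iso_arcs hom" "map_prod \<sigma> \<sigma>"] by simp
    have "(u, w) \<in> parcs G \<longleftrightarrow> (\<sigma> u, \<sigma> w) \<in> parcs G" for u w
    proof
      assume "(u, w) \<in> parcs G"
      then show "(\<sigma> u, \<sigma> w) \<in> parcs G" using im by force
    next
      assume "(\<sigma> u, \<sigma> w) \<in> parcs G"
      then have "(\<sigma> u, \<sigma> w) \<in> map_prod \<sigma> \<sigma> ` parcs G" using im by simp
      then show "(u, w) \<in> parcs G"
        using permutes_inj[OF p] by (auto dest: injD)
    qed
    then show "\<sigma> \<in> automorphisms G" using p by (simp add: automorphisms_def)
  qed
qed

lemma distinguishing_number_attained:
  assumes "pair_graph G"
  shows "1 \<le> distinguishing_number G"
    and "\<exists>\<phi>. distinguishing_labeling G (distinguishing_number G) \<phi>"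
proof -
  interpret G: pair_graph G by fact
  obtain f where f: "bij_betw f (pverts G) {1..card (pverts G)}"
    using bij_betw_iff_card[OF G.pair_finite_verts, of "{1..card (pverts G)}"] by auto
  have "distinguishing_labeling G (Suc (card (pverts G))) f"
    unfolding distinguishing_labeling_def
  proof (intro conjI ballI impI)
    show "f \<in> pverts G \<rightarrow> {1..Suc (card (pverts G))}"
      using bij_betwE[OF f] by fastforce
    fix \<sigma> assume s: "\<sigma> \<in> automorphisms G" "\<sigma> \<noteq> id"
    then have p: "\<sigma> permutes pverts G" by (simp add: automorphisms_def)
    obtain x where x: "\<sigma> x \<noteq> x" using s(2) by fastforce
    then have "x \<in> pverts G" using p by (meson permutes_not_in)
    then show "\<exists>x\<in>pverts G. f x \<noteq> f (\<sigma> x)"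
      using x f p by (metis bij_betw_imp_inj_on inj_onD permutes_in_image)
  qed
  then have "\<exists>r. 1 \<le> r \<and> (\<exists>\<phi>. distinguishing_labeling G r \<phi>)"
    by (intro exI[of _ "Suc (card (pverts G))"]) auto
  from LeastI_ex[OF this, folded distinguishing_number_def]
  show "1 \<le> distinguishing_number G"
    "\<exists>\<phi>. distinguishing_labeling G (distinguishing_number G) \<phi>" by auto
qed

lemma label_class_nonempty:
  assumes "pverts G \<noteq> {}"
    and \<phi>: "distinguishing_labeling G (distinguishing_number G) \<phi>"
    and i: "i \<in> {1..distinguishing_number G}"
  shows "label_class G \<phi> i \<noteq> {}"
proof
  let ?d = "distinguishing_number G"
  assume "label_class G \<phi> i = {}"
  then have ni: "\<phi> x \<noteq> i" if "x \<in> pverts G" for x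
    using that by (auto simp: label_class_def)
  have rng: "\<phi> x \<in> {1..?d}" if "x \<in> pverts G" for x
    using \<phi> that by (auto simp: distinguishing_labeling_def)
  obtain z where "z \<in> pverts G" using assms(1) by blast
  then have d: "2 \<le> ?d" using ni[of z] rng[of z] i by auto
  define \<psi> where "\<psi> x = (if \<phi> x = ?d then i else \<phi> x)" for x
  have r: "\<psi> x \<in> {1..?d - 1}" if "x \<in> pverts G" for x
    using ni[OF that] rng[OF that] i by (auto simp: \<psi>_def)
  have "distinguishing_labeling G (?d - 1) \<psi>"
    unfolding distinguishing_labeling_def
  proof (intro conjI ballI impI)
    show "\<psi> \<in> pverts G \<rightarrow> {1..?d - 1}" using r by blast
    fix \<sigma> assume s: "\<sigma> \<in> automorphisms G" "\<sigma> \<noteq> id"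
    then obtain x where x: "x \<in> pverts G" "\<phi> x \<noteq> \<phi> (\<sigma> x)"
      using \<phi> by (auto simp: distinguishing_labeling_def)
    have "\<sigma> x \<in> pverts G"
      using s(1) x(1) by (simp add: automorphisms_def permutes_in_image)
    then show "\<exists>x\<in>pverts G. \<psi> x \<noteq> \<psi> (\<sigma> x)"
      using x ni by (intro bexI[of _ x]) (auto simp: \<psi>_def)
  qed
  then have "1 \<le> ?d - 1 \<and> (\<exists>\<phi>. distinguishing_labeling G (?d - 1) \<phi>)"
    using d by auto
  then have "(LEAST r. 1 \<le> r \<and> (\<exists>\<phi>. distinguishing_labeling G r \<phi>)) \<le> ?d - 1"
    by (rule Least_le)
  then have "?d \<le> ?d - 1" by (simp only: distinguishing_number_def)
  then show False using d by simp
qed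

end

theory Submission
  imports Defs
begin

text \<open>
  Take optimal distinguishing labelings \<open>\<phi>\<close> of \<open>G\<close> and \<open>\<psi>\<close> of \<open>H\<close>. Permuting the labels turns a
  distinguishing labeling into another one, so the smallest label class may be assumed to be the
  class of label 1 in both (\<open>distinguishing_cost_attained_at_1\<close>). Label the copy of \<open>G\<close> in the
  corona product by \<open>\<phi>\<close> and every copy of \<open>H\<close> by \<open>\<psi>\<close>. This uses the labels
  \<open>1, \<dots>, max k k'\<close>, and the class of label 1 is the union of one minimum class of \<open>G\<close> and
  \<open>n\<close> minimum classes of \<open>H\<close>, which is the claimed bound.

  It remains to see that this labeling is distinguishing. The corona product remembers which of its
  vertices come from \<open>G\<close>: a vertex \<open>u\<close> of \<open>G\<close> is adjacent to the \<open>m\<close> vertices of its copy of \<open>H\<close>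
  and, since \<open>G\<close> is connected with at least two vertices, to some vertex of \<open>G\<close>, so its degree
  exceeds \<open>m\<close>; a vertex of a copy of \<open>H\<close> is adjacent to at most \<open>m - 1\<close> vertices of that copy and to
  one vertex of \<open>G\<close>, so its degree is at most \<open>m\<close>. Hence every automorphism \<open>\<sigma>\<close> of the corona
  product preserves the copy of \<open>G\<close> (\<open>corona_automorphism_Inl\<close>). If \<open>\<sigma>\<close> preserves labels, then
  its restriction to \<open>G\<close> preserves \<open>\<phi>\<close> and is therefore trivial. A copy of \<open>H\<close> consists of the
  neighbours outside \<open>G\<close> of a vertex of \<open>G\<close>, which \<open>\<sigma>\<close> fixes; so \<open>\<sigma>\<close> maps each copy of \<open>H\<close> to
  itself, and since its restriction to that copy preserves \<open>\<psi>\<close>, it is trivial there as well.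
\<close>

section \<open>Restricting automorphisms to invariant induced subgraphs\<close>

lemma automorphism_in_pverts:
  assumes "\<sigma> \<in> automorphisms G" "v \<in> pverts G"
  shows "\<sigma> v \<in> pverts G"
  using assms by (simp add: automorphisms_def permutes_in_image)

lemma automorphism_arc_iff:
  assumes "\<sigma> \<in> automorphisms G" "u \<in> pverts G" "v \<in> pverts G"
  shows "(\<sigma> u, \<sigma> v) \<in> parcs G \<longleftrightarrow> (u, v) \<in> parcs G"
  using assms by (simp add: automorphisms_def)

lemma automorphism_inj:
  assumes "\<sigma> \<in> automorphisms G"
  shows "inj \<sigma>"
  using assms permutes_inj by (auto simp: automorphisms_def)

text \<open>Neighbourhoods are carried to neighbourhoods. The degree of \<open>v\<close> is written as the cardinality
  of \<open>parcs G `` {v}\<close>.\<close>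

lemma automorphism_degree:
  assumes "pair_graph G" and \<sigma>: "\<sigma> \<in> automorphisms G" and v: "v \<in> pverts G"
  shows "card (parcs G `` {\<sigma> v}) = card (parcs G `` {v})"
proof -
  interpret G: pair_graph G by fact
  have p: "\<sigma> permutes pverts G" using \<sigma> by (simp add: automorphisms_def)
  have "parcs G `` {\<sigma> v} = \<sigma> ` (parcs G `` {v})"
  proof (intro equalityI subsetI)
    fix w assume "w \<in> parcs G `` {\<sigma> v}"
    then have w: "(\<sigma> v, w) \<in> parcs G" by simp
    then have "w \<in> pverts G" using G.wellformed' by blast
    then obtain w' where "w' \<in> pverts G" "w = \<sigma> w'" using permutes_image[OF p] by blast
    then show "w \<in> \<sigma> ` (parcs G `` {v})" using w automorphism_arc_iff[OF \<sigma> v] by auto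
  next
    fix w assume "w \<in> \<sigma> ` (parcs G `` {v})"
    then obtain w' where w': "w = \<sigma> w'" "(v, w') \<in> parcs G" by auto
    then have "w' \<in> pverts G" using G.wellformed' by blast
    then show "w \<in> parcs G `` {\<sigma> v}" using w' automorphism_arc_iff[OF \<sigma> v] by auto
  qed
  then show ?thesis
    using card_image[of \<sigma> "parcs G `` {v}"] inj_on_subset[OF automorphism_inj[OF \<sigma>]] by simp
qed

text \<open>This is how a distinguishing labeling of a part of \<open>G\<close> is put to use: conjugating \<open>\<sigma>\<close> by the
  embedding \<open>f\<close> yields an automorphism of \<open>A\<close> that preserves the labeling of \<open>A\<close>, hence the
  identity. Because \<open>A\<close> is finite, it is enough that \<open>\<sigma>\<close> maps the image of \<open>f\<close> into itself.\<close>

lemma automorphism_fixes_distinguished_part: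
  assumes "finite (pverts A)" and inj: "inj_on f (pverts A)"
    and sub: "f ` pverts A \<subseteq> pverts G"
    and arcs: "\<And>x y. x \<in> pverts A \<Longrightarrow> y \<in> pverts A \<Longrightarrow>
      (f x, f y) \<in> parcs G \<longleftrightarrow> (x, y) \<in> parcs A"
    and \<sigma>: "\<sigma> \<in> automorphisms G"
    and inv: "\<sigma> ` f ` pverts A \<subseteq> f ` pverts A"
    and \<phi>: "distinguishing_labeling A r \<phi>"
    and pres: "\<And>x. x \<in> pverts G \<Longrightarrow> \<chi> (\<sigma> x) = \<chi> x"
    and \<chi>: "\<And>x. x \<in> pverts A \<Longrightarrow> \<chi> (f x) = \<phi> x"
    and x: "x \<in> pverts A"
  shows "\<sigma> (f x) = f x"
proof -
  define \<tau> where "\<tau> y = (if y \<in> pverts A then inv_into (pverts A) f (\<sigma> (f y)) else y)" for y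
  have \<tau>_in: "\<tau> y \<in> pverts A" and f_\<tau>: "f (\<tau> y) = \<sigma> (f y)" if "y \<in> pverts A" for y
  proof -
    have "\<sigma> (f y) \<in> f ` pverts A" using inv that by blast
    then show "\<tau> y \<in> pverts A" "f (\<tau> y) = \<sigma> (f y)"
      using that by (auto simp: \<tau>_def inv_into_into f_inv_into_f)
  qed
  have "inj_on \<tau> (pverts A)"
  proof (rule inj_onI)
    fix y z assume yz: "y \<in> pverts A" "z \<in> pverts A" "\<tau> y = \<tau> z"
    then have "\<sigma> (f y) = \<sigma> (f z)" using f_\<tau>[of y] f_\<tau>[of z] by simp
    then have "f y = f z" by (rule injD[OF automorphism_inj[OF \<sigma>]])
    then show "y = z" using inj_onD[OF inj] yz(1,2) by blast
  qed
  moreover have "\<tau> ` pverts A \<subseteq> pverts A" using \<tau>_in by blast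
  ultimately have "bij_betw \<tau> (pverts A) (pverts A)"
    using endo_inj_surj[OF assms(1)] by (simp add: bij_betw_def)
  then have "\<tau> permutes pverts A"
    by (rule bij_imp_permutes) (simp add: \<tau>_def)
  moreover have "(y, z) \<in> parcs A \<longleftrightarrow> (\<tau> y, \<tau> z) \<in> parcs A"
    if "y \<in> pverts A" "z \<in> pverts A" for y z
  proof -
    have "f y \<in> pverts G" "f z \<in> pverts G" using sub that by auto
    then show ?thesis
      using arcs[OF that] arcs[OF \<tau>_in \<tau>_in, OF that] f_\<tau>[OF that(1)] f_\<tau>[OF that(2)]
        automorphism_arc_iff[OF \<sigma>] by simp
  qed
  ultimately have "\<tau> \<in> automorphisms A" by (simp add: automorphisms_def)
  moreover have "\<phi> (\<tau> y) = \<phi> y" if "y \<in> pverts A" for y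
  proof -
    have "f y \<in> pverts G" using sub that by auto
    then show ?thesis
      using \<chi>[OF that] \<chi>[OF \<tau>_in[OF that]] f_\<tau>[OF that] pres[of "f y"] by simp
  qed
  ultimately have "\<tau> = id" using \<phi> by (force simp: distinguishing_labeling_def)
  then show ?thesis using f_\<tau>[OF x] by simp
qed

section \<open>Automorphisms of the corona product\<close>

lemma connected_imp_neighbour:
  assumes "pair_graph G" and "Digraph_Component.connected (with_proj G)"
    and "2 \<le> graph_order G" and u: "u \<in> pverts G"
  shows "\<exists>v. (u, v) \<in> parcs G"
proof -
  interpret G: pair_graph G by fact
  have "pverts G \<noteq> {u}" using assms(3) by auto
  then obtain v where v: "v \<in> pverts G" "v \<noteq> u" using u by blast
  have "u \<rightarrow>\<^sup>*\<^bsub>with_proj G\<^esub> v"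
    using assms(2) u v G.reachable_mk_symmetric_eq
    by (auto simp: connected_def strongly_connected_def)
  then show ?thesis using v(2)
    by (cases rule: G.converse_reachable_cases) (auto)
qed

lemma corona_neighbours_Inl:
  assumes "u \<in> pverts G"
  shows "parcs (corona G H) `` {Inl u} = Inl ` (parcs G `` {u}) \<union> (\<lambda>x. Inr (u, x)) ` pverts H"
  using assms by (auto simp: corona_def)

lemma corona_neighbours_Inr:
  assumes "u \<in> pverts G" "x \<in> pverts H"
  shows "parcs (corona G H) `` {Inr (u, x)} = insert (Inl u) ((\<lambda>y. Inr (u, y)) ` (parcs H `` {x}))"
  using assms by (auto simp: corona_def)

lemma corona_degree_Inl:
  assumes "pair_graph G" "pair_graph H" and "u \<in> pverts G" and "(u, v) \<in> parcs G"
  shows "graph_order H < card (parcs (corona G H) `` {Inl u})"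
proof -
  interpret G: pair_graph G by fact
  interpret H: pair_graph H by fact
  have fin: "finite (parcs G `` {u})" by (simp add: finite_Image)
  then have "0 < card (parcs G `` {u})" using assms(4) by (auto simp: card_gt_0_iff)
  moreover have "card (parcs (corona G H) `` {Inl u})
      = card ((Inl :: _ \<Rightarrow> 'a + 'a \<times> 'b) ` (parcs G `` {u}))
        + card ((\<lambda>x. Inr (u, x) :: 'a + 'a \<times> 'b) ` pverts H)"
    unfolding corona_neighbours_Inl[OF assms(3)]
    using fin by (intro card_Un_disjoint) auto
  ultimately show ?thesis by (simp add: card_image inj_on_def)
qed

lemma corona_degree_Inr:
  assumes "pair_graph H" and "u \<in> pverts G" and x: "x \<in> pverts H"
  shows "card (parcs (corona G H) `` {Inr (u, x)}) \<le> graph_order H"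
proof -
  interpret H: pair_graph H by fact
  \<comment> \<open>A vertex is not its own neighbour, which makes room for the neighbour \<open>Inl u\<close>.\<close>
  have sub: "parcs H `` {x} \<subseteq> pverts H - {x}"
    using H.wellformed'(2)[of x] H.no_loops'[of x x] by auto
  have "card (parcs H `` {x}) \<le> graph_order H - 1"
    using card_mono[OF _ sub] x by simp
  moreover have "0 < graph_order H" using x by (auto simp: card_gt_0_iff)
  moreover have "finite (parcs H `` {x})" by (simp add: finite_Image)
  then have "card (parcs (corona G H) `` {Inr (u, x)}) \<le> Suc (card (parcs H `` {x}))"
    unfolding corona_neighbours_Inr[OF assms(2) x]
    by (simp add: card_insert_if card_image inj_on_def)
  ultimately show ?thesis by linarith
qed

text \<open>By the two bounds above, the vertices coming from \<open>G\<close> are those of degree greater than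
  \<open>graph_order H\<close>.\<close>

lemma corona_automorphism_Inl:
  assumes G: "pair_graph G" and H: "pair_graph H"
    and "Digraph_Component.connected (with_proj G)" and "2 \<le> graph_order G"
    and \<sigma>: "\<sigma> \<in> automorphisms (corona G H)" and v: "v \<in> pverts (corona G H)"
  shows "\<sigma> v \<in> Inl ` pverts G \<longleftrightarrow> v \<in> Inl ` pverts G"
proof -
  have large: "w \<in> Inl ` pverts G \<longleftrightarrow> graph_order H < card (parcs (corona G H) `` {w})"
    if w: "w \<in> pverts (corona G H)" for w
  proof -
    consider u where "u \<in> pverts G" "w = Inl u"
      | u x where "u \<in> pverts G" "x \<in> pverts H" "w = Inr (u, x)"
      using w by (auto simp: corona_def)
    then show ?thesis
    proof cases
      case 1
      then show ?thesis
        using connected_imp_neighbour[OF G assms(3,4)] corona_degree_Inl[OF G H] by blast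
    next
      case 2
      then show ?thesis using corona_degree_Inr[OF H 2(1,2)] by auto
    qed
  qed
  show ?thesis
    using large[OF v] large[OF automorphism_in_pverts[OF \<sigma> v]]
      automorphism_degree[OF pair_graph_corona[OF G H] \<sigma> v] by simp
qed

section \<open>Labelings of the corona product\<close>

lemma corona_labeling_distinguishing:
  assumes G: "pair_graph G" and H: "pair_graph H"
    and conn: "Digraph_Component.connected (with_proj G)" and n: "2 \<le> graph_order G"
    and \<phi>: "distinguishing_labeling G k \<phi>" and \<psi>: "distinguishing_labeling H l \<psi>"
  shows "distinguishing_labeling (corona G H) (max k l) (case_sum \<phi> (\<psi> \<circ> snd))"
    (is "distinguishing_labeling ?C _ ?\<chi>")
  unfolding distinguishing_labeling_def
proof (intro conjI ballI impI)
  have "\<phi> u \<in> {1..max k l}" if "u \<in> pverts G" for u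
    using \<phi> that by (force simp: distinguishing_labeling_def)
  moreover have "\<psi> x \<in> {1..max k l}" if "x \<in> pverts H" for x
    using \<psi> that by (force simp: distinguishing_labeling_def)
  ultimately show "?\<chi> \<in> pverts ?C \<rightarrow> {1..max k l}"
    by (fastforce simp: corona_def)
next
  interpret G: pair_graph G by fact
  interpret H: pair_graph H by fact
  fix \<sigma> assume \<sigma>: "\<sigma> \<in> automorphisms ?C" and "\<sigma> \<noteq> id"
  show "\<exists>v\<in>pverts ?C. ?\<chi> v \<noteq> ?\<chi> (\<sigma> v)"
  proof (rule ccontr)
    assume "\<not> ?thesis"
    then have pres: "?\<chi> (\<sigma> v) = ?\<chi> v" if "v \<in> pverts ?C" for v using that by metis
    have Inl_iff: "\<sigma> v \<in> Inl ` pverts G \<longleftrightarrow> v \<in> Inl ` pverts G" if "v \<in> pverts ?C" for v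
      using corona_automorphism_Inl[OF G H conn n \<sigma> that] .
    have Inl_fixed: "\<sigma> (Inl u) = Inl u" if "u \<in> pverts G" for u
    proof (rule automorphism_fixes_distinguished_part[where \<chi> = ?\<chi>, OF _ _ _ _ \<sigma> _ \<phi> _ _ that])
      show "\<sigma> ` Inl ` pverts G \<subseteq> Inl ` pverts G"
      proof (intro image_subsetI)
        fix w :: "'a + 'a \<times> 'b" assume "w \<in> Inl ` pverts G"
        moreover from this have "w \<in> pverts ?C" by (auto simp: corona_def)
        ultimately show "\<sigma> w \<in> Inl ` pverts G" using Inl_iff by simp
      qed
      show "?\<chi> (\<sigma> v) = ?\<chi> v" if "v \<in> pverts ?C" for v using pres[OF that] .
    qed (auto simp: corona_def)
    have Inr_fixed: "\<sigma> (Inr (u, x)) = Inr (u, x)" if u: "u \<in> pverts G" and x: "x \<in> pverts H" for u x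
    proof (rule automorphism_fixes_distinguished_part[where \<chi> = ?\<chi> and f = "\<lambda>x. Inr (u, x)",
          OF _ _ _ _ \<sigma> _ \<psi> _ _ x])
      show "\<sigma> ` (\<lambda>x. Inr (u, x)) ` pverts H \<subseteq> (\<lambda>x. Inr (u, x)) ` pverts H"
      proof (clarify)
        fix y assume y: "y \<in> pverts H"
        then have v: "Inr (u, y) \<in> pverts ?C" "Inl u \<in> pverts ?C"
          using u by (auto simp: corona_def)
        have "(Inl u, Inr (u, y)) \<in> parcs ?C" using u y by (auto simp: corona_def)
        then have "(Inl u, \<sigma> (Inr (u, y))) \<in> parcs ?C"
          using automorphism_arc_iff[OF \<sigma> v(2,1)] Inl_fixed[OF u] by simp
        then have "\<sigma> (Inr (u, y)) \<in> parcs ?C `` {Inl u}" by simp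
        then have "\<sigma> (Inr (u, y)) \<in> Inl ` pverts G \<union> (\<lambda>x. Inr (u, x)) ` pverts H"
          unfolding corona_neighbours_Inl[OF u] using G.wellformed'(2) by blast
        moreover have "\<sigma> (Inr (u, y)) \<notin> Inl ` pverts G"
          unfolding Inl_iff[OF v(1)] by blast
        ultimately show "\<sigma> (Inr (u, y)) \<in> (\<lambda>x. Inr (u, x)) ` pverts H"
          by blast
      qed
      show "?\<chi> (\<sigma> v) = ?\<chi> v" if "v \<in> pverts ?C" for v using pres[OF that] .
    qed (use u in \<open>auto simp: corona_def inj_on_def\<close>)
    have "\<sigma> v = v" for v
    proof (cases "v \<in> pverts ?C")
      case True
      then consider u where "u \<in> pverts G" "v = Inl u"
        | u x where "u \<in> pverts G" "x \<in> pverts H" "v = Inr (u, x)"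
        by (auto simp: corona_def)
      then show ?thesis using Inl_fixed Inr_fixed by cases simp_all
    next
      case False
      then show ?thesis using \<sigma> by (auto simp: automorphisms_def dest: permutes_not_in)
    qed
    with \<open>\<sigma> \<noteq> id\<close> show False by (simp add: fun_eq_iff)
  qed
qed

lemma card_label_class_corona:
  assumes "finite (pverts G)" "finite (pverts H)"
  shows "card (label_class (corona G H) (case_sum \<phi> (\<psi> \<circ> snd)) i)
    = card (label_class G \<phi> i) + graph_order G * card (label_class H \<psi> i)"
proof -
  have eq: "label_class (corona G H) (case_sum \<phi> (\<psi> \<circ> snd)) i
      = Inl ` label_class G \<phi> i \<union> Inr ` (pverts G \<times> label_class H \<psi> i)"
    by (auto simp: label_class_def corona_def)
  have "finite (label_class G \<phi> i)" "finite (label_class H \<psi> i)"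
    using assms by (simp_all add: label_class_def)
  then show ?thesis
    unfolding eq using assms(1)
    by (subst card_Un_disjoint) (auto simp: card_image card_cartesian_product)
qed

section \<open>Attaining the cost at a prescribed label\<close>

lemma distinguishing_labeling_relabel:
  assumes \<phi>: "distinguishing_labeling G r \<phi>" and \<pi>: "\<pi> permutes {1..r}"
  shows "distinguishing_labeling G r (\<pi> \<circ> \<phi>)"
  using \<phi> permutes_in_image[OF \<pi>] permutes_inj[OF \<pi>]
  by (auto simp: distinguishing_labeling_def Pi_iff inj_eq)

text \<open>The labels of \<open>G\<close> and of \<open>H\<close> with the smallest classes need not agree, nor even be available
  in the other graph; label 1 is always available, and a transposition of labels moves the smallest
  class there.\<close>

lemma distinguishing_cost_attained_at_1:
  assumes "pair_graph G" and d: "d = distinguishing_number G"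
  obtains \<phi> where "distinguishing_labeling G d \<phi>"
    and "card (label_class G \<phi> 1) = distinguishing_cost d G"
proof -
  have one: "1 \<in> {1..d}" using distinguishing_number_attained(1)[OF assms(1)] d by simp
  have "\<exists>s \<phi> i. distinguishing_labeling G d \<phi> \<and> i \<in> {1..d} \<and> s = card (label_class G \<phi> i)"
    using distinguishing_number_attained(2)[OF assms(1)] one d by blast
  from LeastI_ex[OF this, folded distinguishing_cost_def]
  obtain \<phi> i where \<phi>: "distinguishing_labeling G d \<phi>" and i: "i \<in> {1..d}"
    and cost: "distinguishing_cost d G = card (label_class G \<phi> i)"
    by blast
  let ?\<pi> = "transpose i 1"
  have "distinguishing_labeling G d (?\<pi> \<circ> \<phi>)"
    by (rule distinguishing_labeling_relabel[OF \<phi> permutes_swap_id[OF i one]])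
  moreover have "label_class G (?\<pi> \<circ> \<phi>) 1 = label_class G \<phi> i"
    by (auto simp: label_class_def transpose_eq_iff)
  ultimately show thesis using that cost by simp
qed

lemma distinguishing_cost_le:
  assumes "distinguishing_labeling G d \<phi>" and "i \<in> {1..d}"
  shows "distinguishing_cost d G \<le> card (label_class G \<phi> i)"
  unfolding distinguishing_cost_def by (rule Least_le) (use assms in blast)

theorem theorem3p3:
  fixes G :: "'a pair_pre_digraph" and H :: "'b pair_pre_digraph"
    and n m k k' k'' :: nat
  assumes "pair_graph G" and "pair_graph H"
    and "Digraph_Component.connected (with_proj G)"
    and "Digraph_Component.connected (with_proj H)"
    and "graph_order G = n" and "n \<ge> 2"
    and "graph_order H = m" and "m \<ge> 2"
    and "distinguishing_number G = k"
    and "distinguishing_number H = k'"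
    and "k'' = max k k'"
    and "distinguishing_number (corona G H) = k''"
  shows "distinguishing_cost k'' (corona G H) \<le> distinguishing_cost k G + n * distinguishing_cost k' H"
proof -
  interpret G: pair_graph G by fact
  interpret H: pair_graph H by fact
  obtain \<phi> where \<phi>: "distinguishing_labeling G k \<phi>"
    "card (label_class G \<phi> 1) = distinguishing_cost k G"
    using distinguishing_cost_attained_at_1[OF assms(1) assms(9)[symmetric]] .
  obtain \<psi> where \<psi>: "distinguishing_labeling H k' \<psi>"
    "card (label_class H \<psi> 1) = distinguishing_cost k' H"
    using distinguishing_cost_attained_at_1[OF assms(2) assms(10)[symmetric]] .
  have "distinguishing_labeling (corona G H) k'' (case_sum \<phi> (\<psi> \<circ> snd))"
    using corona_labeling_distinguishing[OF assms(1-3) _ \<phi>(1) \<psi>(1)] assms(5,6,11) by simp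
  moreover have "1 \<in> {1..k''}"
    using distinguishing_number_attained(1)[OF assms(1)] assms(9,11) by simp
  ultimately have "distinguishing_cost k'' (corona G H)
      \<le> card (label_class (corona G H) (case_sum \<phi> (\<psi> \<circ> snd)) 1)"
    by (rule distinguishing_cost_le)
  also have "\<dots> = distinguishing_cost k G + n * distinguishing_cost k' H"
    using card_label_class_corona[of G H \<phi> \<psi> 1] \<phi>(2) \<psi>(2) assms(5) by simp
  finally show ?thesis .
qed

end
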